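(* Let $r\colon X\to Y$ be a refinable map, where $X$ is a normal space and $Y$ is a paracompact space. If $X$ is a finite $C$-space, then $Y$ is a finite $C$-space.
   Context: All spaces are assumed to be normal and all maps are continuous. A space $X$ is called a finite $C$-space if for any sequence $\{\omega_i\}_{i\ge1}$ of open covers of $X$ there exist $n$ and disjoint open families $\gamma_1,\dots,\gamma_n$ (each $\gamma_i$ consists of pairwise disjoint open subsets of $X$) such that each $\gamma_i$ refines $\omega_i$ (every element of $\gamma_i$ is contained in an element of $\omega_i$) and $\bigcup_{i=1}^n\gamma_i$ covers $X$. For an open cover $\omega$ of $X$, a continuous map $f\colon X\to Y$ is called an $\omega$-map if there is an open cover $\gamma$ of $Y$ such that $f^{-1}(\gamma)=\{f^{-1}(G):G\in\gamma\}$ refines $\omega$. A surjective continuous map $r\colon X\to Y$ is called refinable if for any locally finite open cover $\omega$ of $X$ and any open cover $\gamma$ of $Y$ there exists a surjective $\omega$-map $f\colon X\to Y$ such that $r$ and $f$ are $\gamma$-close, i.e. for every $x\in X$ there is an element of $\gamma$ containing both $r(x)$ and $f(x)$. *)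

theory Defs
  imports "HOL-Analysis.Analysis"
begin

text \<open>
  Separation axioms are not built into the notions below; they appear as explicit
  hypotheses where needed. In particular \<open>paracompact_space\<close> is the bare covering
  property, without the Hausdorff axiom.
\<close>

definition open_cover_of :: "'a topology \<Rightarrow> 'a set set \<Rightarrow> bool" where
  "open_cover_of X \<U> \<longleftrightarrow> (\<forall>U\<in>\<U>. openin X U) \<and> \<Union>\<U> = topspace X"

text \<open>The library's \<open>refines\<close> is about partitions, hence the separate notion.\<close>

definition family_refines :: "'a set set \<Rightarrow> 'a set set \<Rightarrow> bool" where
  "family_refines \<V> \<U> \<longleftrightarrow> (\<forall>V\<in>\<V>. \<exists>U\<in>\<U>. V \<subseteq> U)"

definition paracompact_space :: "'a topology \<Rightarrow> bool" where
  "paracompact_space X \<longleftrightarrow>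
     (\<forall>\<U>. open_cover_of X \<U> \<longrightarrow>
        (\<exists>\<V>. open_cover_of X \<V> \<and> family_refines \<V> \<U> \<and> locally_finite_in X \<V>))"

definition disjoint_open_family :: "'a topology \<Rightarrow> 'a set set \<Rightarrow> bool" where
  "disjoint_open_family X \<V> \<longleftrightarrow> (\<forall>V\<in>\<V>. openin X V) \<and> pairwise disjnt \<V>"

text \<open>Only the values at indices \<open>i \<ge> 1\<close> of the sequences are used.\<close>

definition finite_C_space :: "'a topology \<Rightarrow> bool" where
  "finite_C_space X \<longleftrightarrow>
     (\<forall>\<omega> :: nat \<Rightarrow> 'a set set. (\<forall>i\<ge>1. open_cover_of X (\<omega> i)) \<longrightarrow>
        (\<exists>(n::nat) (\<gamma> :: nat \<Rightarrow> 'a set set).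
           (\<forall>i\<in>{1..n}. disjoint_open_family X (\<gamma> i) \<and> family_refines (\<gamma> i) (\<omega> i)) \<and>
           open_cover_of X (\<Union>i\<in>{1..n}. \<gamma> i)))"

definition omega_map :: "'a topology \<Rightarrow> 'b topology \<Rightarrow> 'a set set \<Rightarrow> ('a \<Rightarrow> 'b) \<Rightarrow> bool" where
  "omega_map X Y \<omega> f \<longleftrightarrow>
     continuous_map X Y f \<and>
     (\<exists>\<gamma>. open_cover_of Y \<gamma> \<and> family_refines {{x \<in> topspace X. f x \<in> G} |G. G \<in> \<gamma>} \<omega>)"

definition maps_close :: "'a topology \<Rightarrow> 'b set set \<Rightarrow> ('a \<Rightarrow> 'b) \<Rightarrow> ('a \<Rightarrow> 'b) \<Rightarrow> bool" where
  "maps_close X \<gamma> r f \<longleftrightarrow> (\<forall>x\<in>topspace X. \<exists>G\<in>\<gamma>. r x \<in> G \<and> f x \<in> G)"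

definition refinable_map :: "'a topology \<Rightarrow> 'b topology \<Rightarrow> ('a \<Rightarrow> 'b) \<Rightarrow> bool" where
  "refinable_map X Y r \<longleftrightarrow>
     continuous_map X Y r \<and> r ` topspace X = topspace Y \<and>
     (\<forall>\<omega> \<gamma>. open_cover_of X \<omega> \<and> locally_finite_in X \<omega> \<and> open_cover_of Y \<gamma> \<longrightarrow>
        (\<exists>f. omega_map X Y \<omega> f \<and> f ` topspace X = topspace Y \<and> maps_close X \<gamma> r f))"

end

theory Submission
  imports Defs
begin

text \<open>
  Given open covers \<open>\<omega> i\<close> of \<open>Y\<close>, the covers are first refined to open covers \<open>\<L> i\<close> with some
  room to spare: the members of a further open cover \<open>\<N> i\<close> that meet a given \<open>L \<in> \<L> i\<close> all lie
  in one element of \<open>\<omega> i\<close> (\<open>star_refinement\<close>). The finite \<open>C\<close>-property of \<open>X\<close>, applied to the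
  preimages of the \<open>\<L> i\<close> under \<open>r\<close>, gives finitely many disjoint open families
  \<open>\<gamma> 1, \<dots>, \<gamma> n\<close> that together cover \<open>X\<close>. They are carried over to \<open>Y\<close> not by \<open>r\<close>, whose
  fibres may be too large to fit into elements of the \<open>\<gamma> i\<close>, but by an approximation \<open>f\<close> of \<open>r\<close>
  with small fibres.

  Each \<open>G\<close> is replaced by its core, the largest open set of \<open>Y\<close> whose preimage under \<open>f\<close> lies in
  \<open>G\<close>. As \<open>f\<close> is onto, disjoint sets have disjoint cores. The cores of all \<open>G\<close> cover \<open>Y\<close> as
  soon as \<open>f\<close> is an \<open>\<omega>\<close>-map for a cover refining \<open>\<Union>i. \<gamma> i\<close>. Finally, if \<open>G\<close> is sent by \<open>r\<close> into
  \<open>L \<in> \<L> i\<close>, and \<open>f\<close> is close to \<open>r\<close> relative to a cover refining \<open>\<N> 1, \<dots>, \<N> n\<close>, then each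
  point of the core of \<open>G\<close> lies in a member of \<open>\<N> i\<close> that meets \<open>L\<close>, hence the core lies in an
  element of \<open>\<omega> i\<close>.

  Refinability only provides \<open>\<omega>\<close>-maps for locally finite covers, whereas \<open>\<Union>i. \<gamma> i\<close> need not be
  locally finite. Here normality of \<open>X\<close> enters: the finite cover by the unions \<open>\<Union>(\<gamma> i)\<close> can be
  shrunk to open sets \<open>V i\<close> with closure inside \<open>\<Union>(\<gamma> i)\<close>, and then, for each \<open>i\<close>, the
  traces of \<open>\<gamma> i\<close> on \<open>V i\<close> form a discrete family (\<open>locally_finite_traces\<close>).
\<close>

section \<open>Refining open covers of normal spaces\<close>

text \<open>
  The cover is shrunk one member at a time along a well-ordering of the indices. At stage \<open>i\<close>
  the set \<open>V i\<close> has to contain all points covered neither by the new sets before \<open>i\<close> nor by the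
  old sets after \<open>i\<close>. These form a closed set, and it lies in \<open>U i\<close>: the set \<open>U k\<close> with the
  greatest index among the finitely many containing a given point has already been treated if
  \<open>k < i\<close>. The same remark shows that the final sets cover.
\<close>

lemma point_finite_shrinking:
  fixes U :: "'i \<Rightarrow> 'a set"
  assumes normal: "normal_space X"
    and opn: "\<And>i. i \<in> I \<Longrightarrow> openin X (U i)"
    and cover: "(\<Union>i\<in>I. U i) = topspace X"
    and point_finite: "\<And>x. x \<in> topspace X \<Longrightarrow> finite {i\<in>I. x \<in> U i}"
  obtains V where "\<And>i. i \<in> I \<Longrightarrow> openin X (V i)"
    and "\<And>i. i \<in> I \<Longrightarrow> X closure_of V i \<subseteq> U i"
    and "(\<Union>i\<in>I. V i) = topspace X"
proof -
  obtain w :: "'i rel" where w: "well_order_on UNIV w"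
    using well_order_on by blast
  define R where "R = w - Id"
  have "wf R"
    using w by (simp add: R_def well_order_on_def)
  have lin: "linear_order_on UNIV w"
    using w by (simp add: well_order_on_def)
  have total: "(i, j) \<in> R \<or> (j, i) \<in> R" if "i \<noteq> j" for i j
    using lin that by (auto simp: R_def linear_order_on_def total_on_def)
  have trans: "(i, k) \<in> R" if "(i, j) \<in> R" "(j, k) \<in> R" for i j k
    using lin that
    by (auto simp: R_def linear_order_on_def partial_order_on_def preorder_on_def
        dest: transD antisymD)
  have irrefl: "(i, i) \<notin> R" for i
    by (simp add: R_def)

  define rest where
    "rest f i = topspace X - ((\<Union>j\<in>{j\<in>I. (j, i) \<in> R}. f j) \<union> (\<Union>j\<in>{j\<in>I. (i, j) \<in> R}. U j))"
    for f :: "'i \<Rightarrow> 'a set" and i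
  define P where
    "P f i W \<longleftrightarrow> (i \<in> I \<longrightarrow> openin X W \<and> rest f i \<subseteq> W \<and> X closure_of W \<subseteq> U i)"
    for f :: "'i \<Rightarrow> 'a set" and i W

  \<comment> \<open>Point-finiteness gives every point a last member of the cover that contains it.\<close>
  have last: "\<exists>k\<in>I. x \<in> U k \<and> (\<forall>j\<in>I. x \<in> U j \<longrightarrow> (k, j) \<notin> R)" if x: "x \<in> topspace X" for x
  proof -
    have "{i\<in>I. x \<in> U i} \<noteq> {}"
      using cover x by auto
    moreover have "asymp_on A (\<lambda>i j. (i, j) \<in> R)" "transp_on A (\<lambda>i j. (i, j) \<in> R)" for A
      using trans irrefl by (blast intro: asymp_onI transp_onI)+
    ultimately obtain k where "k \<in> {i\<in>I. x \<in> U i}"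
      "\<forall>j\<in>{i\<in>I. x \<in> U i}. j \<noteq> k \<longrightarrow> (k, j) \<notin> R"
      using Finite_Set.bex_max_element[OF point_finite[OF x], of "\<lambda>i j. (i, j) \<in> R"]
      by meson
    then show ?thesis
      using irrefl by (intro bexI[of _ k]) auto
  qed
  \<comment> \<open>Once that last member has been shrunk, the point can no longer be lost.\<close>
  have treated: "\<exists>j\<in>I. x \<in> f j \<and> (j = k \<or> (j, k) \<in> R)"
    if "x \<in> topspace X" "k \<in> I" "\<forall>j\<in>I. x \<in> U j \<longrightarrow> (k, j) \<notin> R" "P f k (f k)" for x k f
    using that unfolding P_def rest_def by blast

  have "\<exists>V. \<forall>i. P V i (V i)"
  proof (rule dependent_wf_choice[OF \<open>wf R\<close>])
    show "P f i W = P g i W" if "\<And>j. (j, i) \<in> R \<Longrightarrow> f j = g j" for f g i W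
      using that by (simp add: P_def rest_def)
  next
    fix i f
    assume IH: "\<And>j. (j, i) \<in> R \<Longrightarrow> P f j (f j)"
    show "\<exists>W. P f i W"
    proof (cases "i \<in> I")
      case True
      have "openin X ((\<Union>j\<in>{j\<in>I. (j, i) \<in> R}. f j) \<union> (\<Union>j\<in>{j\<in>I. (i, j) \<in> R}. U j))"
        using IH opn by (intro openin_Un openin_Union) (auto simp: P_def)
      then have "closedin X (rest f i)"
        by (simp add: rest_def closedin_diff)
      moreover have "rest f i \<subseteq> U i"
      proof
        fix x
        assume x: "x \<in> rest f i"
        then have "x \<in> topspace X"
          by (simp add: rest_def)
        then obtain k where k: "k \<in> I" "x \<in> U k" "\<forall>j\<in>I. x \<in> U j \<longrightarrow> (k, j) \<notin> R"
          using last by blast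
        have "(i, k) \<notin> R"
          using x k by (auto simp: rest_def)
        moreover have "(k, i) \<notin> R"
        proof
          assume "(k, i) \<in> R"
          then obtain j where j: "j \<in> I" "x \<in> f j" "j = k \<or> (j, k) \<in> R"
            using treated[OF \<open>x \<in> topspace X\<close> k(1,3) IH] by blast
          then have "(j, i) \<in> R"
            using \<open>(k, i) \<in> R\<close> trans by blast
          with j show False
            using x unfolding rest_def by blast
        qed
        ultimately show "x \<in> U i"
          using total[of i k] k(2) by blast
      qed
      ultimately obtain W where "openin X W" "rest f i \<subseteq> W" "X closure_of W \<subseteq> U i"
        using normal[unfolded normal_space_alt, rule_format, of "rest f i" "U i"] opn[OF True]
        by metis
      then show ?thesis
        by (auto simp: P_def)
    qed (simp add: P_def)
  qed
  then obtain V where V: "\<And>i. P V i (V i)"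
    by blast
  show thesis
  proof
    show "openin X (V i)" "X closure_of V i \<subseteq> U i" if "i \<in> I" for i
      using V that by (auto simp: P_def)
    then have "(\<Union>i\<in>I. V i) \<subseteq> topspace X"
      by (intro UN_least openin_subset)
    moreover have "x \<in> (\<Union>i\<in>I. V i)" if "x \<in> topspace X" for x
      using last[OF that] treated[OF that _ _ V] by blast
    ultimately show "(\<Union>i\<in>I. V i) = topspace X"
      by blast
  qed
qed

text \<open>
  After passing to a locally finite refinement \<open>\<W>\<close> and shrinking it to sets \<open>V W\<close>, a point \<open>y\<close>
  has a neighbourhood \<open>N\<close> that avoids the closures of all \<open>V W\<close> not adherent to \<open>y\<close> and lies in
  all \<open>W\<close> for which \<open>V W\<close> is adherent to \<open>y\<close>. If \<open>N\<close> meets \<open>V W\<close>, then \<open>V W\<close> is of the second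
  kind, so \<open>N \<subseteq> W\<close>.
\<close>

lemma star_refinement:
  assumes normal: "normal_space Y" and para: "paracompact_space Y"
    and \<U>: "open_cover_of Y \<U>"
  shows "\<exists>\<L> \<N>. open_cover_of Y \<L> \<and> open_cover_of Y \<N> \<and>
           (\<forall>L\<in>\<L>. \<exists>U\<in>\<U>. \<forall>N\<in>\<N>. N \<inter> L \<noteq> {} \<longrightarrow> N \<subseteq> U)"
proof -
  obtain \<W> where \<W>: "open_cover_of Y \<W>" "family_refines \<W> \<U>" "locally_finite_in Y \<W>"
    using para \<U> unfolding paracompact_space_def by blast
  have point_finite: "finite {W\<in>\<W>. y \<in> W}" if y: "y \<in> topspace Y" for y
  proof -
    obtain T where "y \<in> T" "finite {W\<in>\<W>. W \<inter> T \<noteq> {}}"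
      using \<W>(3) y unfolding locally_finite_in_def by blast
    then show ?thesis
      by (elim finite_subset[rotated]) auto
  qed
  obtain V where V: "\<And>W. W \<in> \<W> \<Longrightarrow> openin Y (V W)"
    "\<And>W. W \<in> \<W> \<Longrightarrow> Y closure_of V W \<subseteq> W" "(\<Union>W\<in>\<W>. V W) = topspace Y"
    using point_finite_shrinking[OF normal, of \<W> "\<lambda>W. W"] \<W>(1) point_finite
    unfolding open_cover_of_def by auto
  have subset: "V W \<subseteq> Y closure_of V W" if "W \<in> \<W>" for W
    using V(1)[OF that] by (simp add: closure_of_subset openin_subset)

  define \<N> where "\<N> = {N. openin Y N \<and> (\<forall>W\<in>\<W>. N \<inter> V W \<noteq> {} \<longrightarrow> N \<subseteq> W)}"
  have "\<exists>N\<in>\<N>. y \<in> N" if y: "y \<in> topspace Y" for y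
  proof -
    let ?far = "\<Union>((\<lambda>W. Y closure_of V W) ` {W\<in>\<W>. y \<notin> Y closure_of V W})"
    let ?near = "{W\<in>\<W>. y \<in> Y closure_of V W}"
    have "locally_finite_in Y ((\<lambda>W. Y closure_of V W) ` {W\<in>\<W>. y \<notin> Y closure_of V W})"
      using V(2) by (intro locally_finite_in_refinement locally_finite_in_subset[OF \<W>(3)]) auto
    then have "closedin Y ?far"
      by (intro closedin_locally_finite_Union) auto
    moreover have "finite ?near"
      using V(2) by (intro finite_subset[OF _ point_finite[OF y]]) auto
    then have "openin Y ((\<Inter>W\<in>?near. W) \<inter> topspace Y)"
      using \<W>(1) by (intro openin_INT) (auto simp: open_cover_of_def)
    ultimately have "openin Y (((\<Inter>W\<in>?near. W) \<inter> topspace Y) - ?far)" (is "openin Y ?N")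
      by (intro openin_diff)
    moreover have "y \<in> ?N"
      using y V(2) by auto
    moreover have "?N \<subseteq> W" if "W \<in> \<W>" "?N \<inter> V W \<noteq> {}" for W
      using that subset by blast
    ultimately have "?N \<in> \<N>"
      by (simp add: \<N>_def)
    then show ?thesis
      using \<open>y \<in> ?N\<close> by (rule rev_bexI)
  qed
  then have "open_cover_of Y \<N>"
    using openin_subset by (fastforce simp: open_cover_of_def \<N>_def)
  moreover have "open_cover_of Y (V ` \<W>)"
    using V by (auto simp: open_cover_of_def)
  moreover have "\<exists>U\<in>\<U>. \<forall>N\<in>\<N>. N \<inter> V W \<noteq> {} \<longrightarrow> N \<subseteq> U" if W: "W \<in> \<W>" for W
  proof -
    obtain U where "U \<in> \<U>" "W \<subseteq> U"
      using \<W>(2) W unfolding family_refines_def by blast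
    moreover have "\<forall>N\<in>\<N>. N \<inter> V W \<noteq> {} \<longrightarrow> N \<subseteq> W"
      using W by (simp add: \<N>_def)
    ultimately show ?thesis
      by (meson subset_trans)
  qed
  ultimately show ?thesis
    by (intro exI[of _ "V ` \<W>"] exI[of _ \<N>]) simp
qed

lemma common_open_refinement:
  assumes "finite I" and covers: "\<And>i. i \<in> I \<Longrightarrow> open_cover_of Y (\<N> i)"
  obtains \<G> where "open_cover_of Y \<G>" and "\<And>i. i \<in> I \<Longrightarrow> family_refines \<G> (\<N> i)"
proof
  let ?\<G> = "{N. openin Y N \<and> (\<forall>i\<in>I. \<exists>M\<in>\<N> i. N \<subseteq> M)}"
  show "family_refines ?\<G> (\<N> i)" if "i \<in> I" for i
    using that by (auto simp: family_refines_def)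
  have "\<exists>N\<in>?\<G>. y \<in> N" if y: "y \<in> topspace Y" for y
  proof -
    have "\<forall>i\<in>I. \<exists>M. M \<in> \<N> i \<and> openin Y M \<and> y \<in> M"
      using covers y unfolding open_cover_of_def by blast
    then obtain M where M: "\<And>i. i \<in> I \<Longrightarrow> M i \<in> \<N> i \<and> openin Y (M i) \<and> y \<in> M i"
      by metis
    then have "openin Y ((\<Inter>i\<in>I. M i) \<inter> topspace Y)"
      using \<open>finite I\<close> by blast
    then show ?thesis
      using M y by (intro bexI[of _ "(\<Inter>i\<in>I. M i) \<inter> topspace Y"]) auto
  qed
  then show "open_cover_of Y ?\<G>"
    using openin_subset by (fastforce simp: open_cover_of_def)
qed

section \<open>Traces of disjoint families\<close>

text \<open>
  A single family of traces \<open>V i \<inter> G\<close> is discrete: a point in some \<open>G\<close> has \<open>G\<close> itself as a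
  neighbourhood meeting no other trace, and a point outside \<open>\<Union>(\<gamma> i)\<close> lies outside the closure
  of \<open>V i\<close>, whose complement meets no trace.
\<close>

lemma locally_finite_traces:
  assumes "finite I"
    and disj: "\<And>i. i \<in> I \<Longrightarrow> disjoint_open_family X (\<gamma> i)"
    and V: "\<And>i. i \<in> I \<Longrightarrow> openin X (V i)"
    and clV: "\<And>i. i \<in> I \<Longrightarrow> X closure_of V i \<subseteq> \<Union>(\<gamma> i)"
  shows "locally_finite_in X (\<Union>i\<in>I. (\<lambda>G. V i \<inter> G) ` \<gamma> i)"
  unfolding locally_finite_in_def
proof (intro conjI ballI)
  show "\<Union>(\<Union>i\<in>I. (\<lambda>G. V i \<inter> G) ` \<gamma> i) \<subseteq> topspace X"
    using V openin_subset by fastforce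
next
  fix x
  assume x: "x \<in> topspace X"
  have "\<exists>N. openin X N \<and> x \<in> N \<and> finite {T \<in> (\<lambda>G. V i \<inter> G) ` \<gamma> i. T \<inter> N \<noteq> {}}"
    if i: "i \<in> I" for i
  proof (cases "x \<in> \<Union>(\<gamma> i)")
    case True
    then obtain G where G: "G \<in> \<gamma> i" "x \<in> G"
      by blast
    have "H = G" if "H \<in> \<gamma> i" "H \<inter> G \<noteq> {}" for H
      using disj[OF i] G(1) that
      by (metis disjnt_def disjoint_open_family_def pairwiseD)
    then have "{T \<in> (\<lambda>G. V i \<inter> G) ` \<gamma> i. T \<inter> G \<noteq> {}} \<subseteq> {V i \<inter> G}"
      by blast
    then show ?thesis
      using G disj[OF i] finite_subset unfolding disjoint_open_family_def by blast
  next
    case False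
    have "V i \<subseteq> X closure_of V i"
      using V[OF i] by (simp add: closure_of_subset openin_subset)
    then have empty: "{T \<in> (\<lambda>G. V i \<inter> G) ` \<gamma> i. T \<inter> (topspace X - X closure_of V i) \<noteq> {}} = {}"
      by blast
    have "x \<in> topspace X - X closure_of V i"
      using False clV[OF i] x by blast
    moreover have "openin X (topspace X - X closure_of V i)"
      by (simp add: openin_diff)
    ultimately show ?thesis
      by (intro exI[of _ "topspace X - X closure_of V i"] conjI) (simp_all only: empty finite.emptyI)
  qed
  then have "\<forall>i\<in>I. \<exists>N. openin X N \<and> x \<in> N \<and> finite {T \<in> (\<lambda>G. V i \<inter> G) ` \<gamma> i. T \<inter> N \<noteq> {}}"
    by (rule ballI)
  from bchoice[OF this]
  obtain N where N: "\<And>i. i \<in> I \<Longrightarrow> openin X (N i)" "\<And>i. i \<in> I \<Longrightarrow> x \<in> N i"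
    "\<And>i. i \<in> I \<Longrightarrow> finite {T \<in> (\<lambda>G. V i \<inter> G) ` \<gamma> i. T \<inter> N i \<noteq> {}}"
    by blast
  let ?N = "(\<Inter>i\<in>I. N i) \<inter> topspace X"
  have "{T \<in> \<Union>i\<in>I. (\<lambda>G. V i \<inter> G) ` \<gamma> i. T \<inter> ?N \<noteq> {}}
      \<subseteq> (\<Union>i\<in>I. {T \<in> (\<lambda>G. V i \<inter> G) ` \<gamma> i. T \<inter> N i \<noteq> {}})"
    by blast
  moreover have "finite (\<Union>i\<in>I. {T \<in> (\<lambda>G. V i \<inter> G) ` \<gamma> i. T \<inter> N i \<noteq> {}})"
    using \<open>finite I\<close> N(3) by blast
  ultimately have "finite {T \<in> \<Union>i\<in>I. (\<lambda>G. V i \<inter> G) ` \<gamma> i. T \<inter> ?N \<noteq> {}}"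
    by (rule finite_subset)
  moreover have "openin X ?N"
    using \<open>finite I\<close> N(1) by blast
  ultimately show "\<exists>N. openin X N \<and> x \<in> N \<and>
      finite {T \<in> \<Union>i\<in>I. (\<lambda>G. V i \<inter> G) ` \<gamma> i. T \<inter> N \<noteq> {}}"
    using N(2) x by (intro exI[of _ ?N]) auto
qed

section \<open>Cores\<close>

text \<open>
  For a closed map \<open>f\<close> and an open set \<open>G\<close> this is the set of points whose whole fibre lies in \<open>G\<close>. In general that
  set need not be open, and the core is its interior.
\<close>

definition core :: "'a topology \<Rightarrow> 'b topology \<Rightarrow> ('a \<Rightarrow> 'b) \<Rightarrow> 'a set \<Rightarrow> 'b set" where
  "core X Y f G = \<Union>{D. openin Y D \<and> {x \<in> topspace X. f x \<in> D} \<subseteq> G}"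

lemma openin_core: "openin Y (core X Y f G)"
  by (auto simp: core_def)

lemma preimage_core_subset: "x \<in> topspace X \<Longrightarrow> f x \<in> core X Y f G \<Longrightarrow> x \<in> G"
  by (auto simp: core_def)

lemma core_subset_image:
  assumes "f ` topspace X = topspace Y" and "y \<in> core X Y f G"
  obtains x where "x \<in> topspace X" "x \<in> G" "f x = y"
proof -
  have "y \<in> f ` topspace X"
    using assms openin_subset[OF openin_core[of Y X f G]] by auto
  then obtain x where x: "x \<in> topspace X" "f x = y"
    by blast
  then have "x \<in> G"
    using assms(2) by (auto intro: preimage_core_subset)
  with x show thesis
    using that by blast
qed

lemma disjoint_open_family_cores:
  assumes "f ` topspace X = topspace Y" and "disjoint_open_family X \<V>"
  shows "disjoint_open_family Y (core X Y f ` \<V>)"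
  unfolding disjoint_open_family_def
proof (intro conjI ballI pairwiseI)
  fix C D
  assume "C \<in> core X Y f ` \<V>" "D \<in> core X Y f ` \<V>" "C \<noteq> D"
  then obtain G H where GH: "G \<in> \<V>" "H \<in> \<V>" "G \<noteq> H" "C = core X Y f G" "D = core X Y f H"
    by auto
  have "G \<inter> H = {}"
    using GH(1-3) assms(2) by (metis disjnt_def disjoint_open_family_def pairwiseD)
  have False if y: "y \<in> core X Y f G" "y \<in> core X Y f H" for y
  proof -
    obtain x where "x \<in> topspace X" "x \<in> G" "f x = y"
      using core_subset_image[OF assms(1) y(1)] .
    then show False
      using preimage_core_subset[of x X f Y H] y(2) \<open>G \<inter> H = {}\<close> by blast
  qed
  then show "disjnt C D"
    using GH(4,5) by (auto simp: disjnt_iff)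
qed (auto intro: openin_core)

text \<open>
  If the preimage of an open set \<open>D\<close> lies in a member of \<open>\<V>\<close>, then \<open>D\<close> lies in the core of that
  member; an \<open>\<omega>\<close>-map yields a cover of \<open>Y\<close> by such sets \<open>D\<close>.
\<close>

lemma open_cover_of_cores:
  assumes "omega_map X Y \<omega> f" and "family_refines \<omega> \<V>"
  shows "open_cover_of Y (core X Y f ` \<V>)"
proof -
  obtain \<D> where \<D>: "open_cover_of Y \<D>"
    "family_refines {{x \<in> topspace X. f x \<in> D} |D. D \<in> \<D>} \<omega>"
    using assms(1) unfolding omega_map_def by blast
  have "\<exists>G\<in>\<V>. y \<in> core X Y f G" if y: "y \<in> topspace Y" for y
  proof -
    obtain D where D: "D \<in> \<D>" "y \<in> D" "openin Y D"
      using \<D>(1) y unfolding open_cover_of_def by blast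
    have "\<exists>W\<in>\<omega>. {x \<in> topspace X. f x \<in> D} \<subseteq> W"
      using \<D>(2) D(1) unfolding family_refines_def by (elim ballE) auto
    then obtain G where "G \<in> \<V>" "{x \<in> topspace X. f x \<in> D} \<subseteq> G"
      using assms(2) unfolding family_refines_def by (meson subset_trans)
    then show ?thesis
      using D unfolding core_def by blast
  qed
  moreover have "core X Y f G \<subseteq> topspace Y" for G
    by (intro openin_subset openin_core)
  ultimately show ?thesis
    unfolding open_cover_of_def by (blast intro: openin_core)
qed

section \<open>Refinable images of finite C-spaces\<close>

theorem theorem4p3:
  fixes X :: "'a topology" and Y :: "'b topology" and r :: "'a \<Rightarrow> 'b"
  assumes "normal_space X"
    and "normal_space Y"
    and "paracompact_space Y"
    and "refinable_map X Y r"
    and "finite_C_space X"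
  shows "finite_C_space Y"
  unfolding finite_C_space_def
proof (intro allI impI)
  fix \<omega> :: "nat \<Rightarrow> 'b set set"
  assume \<omega>: "\<forall>i\<ge>1. open_cover_of Y (\<omega> i)"
  have r: "continuous_map X Y r"
    using assms(4) by (simp add: refinable_map_def)
  have "\<forall>i\<in>{1..}. \<exists>\<L> \<N>. open_cover_of Y \<L> \<and> open_cover_of Y \<N> \<and>
           (\<forall>L\<in>\<L>. \<exists>U\<in>\<omega> i. \<forall>N\<in>\<N>. N \<inter> L \<noteq> {} \<longrightarrow> N \<subseteq> U)"
    using \<omega> star_refinement[OF assms(2,3)] by simp
  then obtain \<L> \<N> where \<L>: "\<And>i. i \<ge> 1 \<Longrightarrow> open_cover_of Y (\<L> i)"
    and \<N>: "\<And>i. i \<ge> 1 \<Longrightarrow> open_cover_of Y (\<N> i)"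
    and star: "\<And>i L. i \<ge> 1 \<Longrightarrow> L \<in> \<L> i \<Longrightarrow> \<exists>U\<in>\<omega> i. \<forall>N\<in>\<N> i. N \<inter> L \<noteq> {} \<longrightarrow> N \<subseteq> U"
    by (metis atLeast_iff)

  have "open_cover_of X ((\<lambda>L. {x \<in> topspace X. r x \<in> L}) ` \<L> i)" if "i \<ge> 1" for i
    using \<L>[OF that] r continuous_map_image_subset_topspace[OF r]
    by (fastforce simp: open_cover_of_def intro: openin_continuous_map_preimage)
  then obtain n \<gamma> where
    disj: "\<And>i. i \<in> {1..n} \<Longrightarrow> disjoint_open_family X (\<gamma> i)" and
    ref: "\<And>i. i \<in> {1..n} \<Longrightarrow>
      family_refines (\<gamma> i) ((\<lambda>L. {x \<in> topspace X. r x \<in> L}) ` \<L> i)" and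
    cov: "open_cover_of X (\<Union>i\<in>{1..n}. \<gamma> i)"
    using assms(5)[unfolded finite_C_space_def, rule_format,
        of "\<lambda>i. (\<lambda>L. {x \<in> topspace X. r x \<in> L}) ` \<L> i"]
    by blast

  have opn: "openin X (\<Union>(\<gamma> i))" if "i \<in> {1..n}" for i
    using disj[OF that] by (auto simp: disjoint_open_family_def)
  have "(\<Union>i\<in>{1..n}. \<Union>(\<gamma> i)) = \<Union>(\<Union>i\<in>{1..n}. \<gamma> i)"
    by blast
  then have covX: "(\<Union>i\<in>{1..n}. \<Union>(\<gamma> i)) = topspace X"
    using cov unfolding open_cover_of_def by simp
  have fin: "finite {i\<in>{1..n}. x \<in> \<Union>(\<gamma> i)}" for x
    by simp
  obtain V where V: "\<And>i. i \<in> {1..n} \<Longrightarrow> openin X (V i)"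
    "\<And>i. i \<in> {1..n} \<Longrightarrow> X closure_of V i \<subseteq> \<Union>(\<gamma> i)" "(\<Union>i\<in>{1..n}. V i) = topspace X"
    by (rule point_finite_shrinking[OF assms(1) opn covX fin]) (assumption, rule that)
  \<comment> \<open>The traces replace \<open>\<Union>i. \<gamma> i\<close> only in the choice of \<open>f\<close>; the cores are taken of the
    original sets, which the traces refine.\<close>
  define \<T> where "\<T> = (\<Union>i\<in>{1..n}. (\<lambda>G. V i \<inter> G) ` \<gamma> i)"
  have "locally_finite_in X \<T>"
    unfolding \<T>_def using disj V by (intro locally_finite_traces) auto
  moreover have "open_cover_of X \<T>"
    unfolding open_cover_of_def
  proof
    show "\<forall>T\<in>\<T>. openin X T"
      using V(1) disj by (auto simp: \<T>_def disjoint_open_family_def)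
    have "V i \<inter> \<Union>(\<gamma> i) = V i" if "i \<in> {1..n}" for i
      using closure_of_subset[OF openin_subset[OF V(1)[OF that]]] V(2)[OF that] by blast
    moreover have "\<Union>\<T> = (\<Union>i\<in>{1..n}. V i \<inter> \<Union>(\<gamma> i))"
      unfolding \<T>_def by blast
    ultimately show "\<Union>\<T> = topspace X"
      using V(3) by simp
  qed
  moreover obtain \<G> where \<G>: "open_cover_of Y \<G>" "\<And>i. i \<in> {1..n} \<Longrightarrow> family_refines \<G> (\<N> i)"
    using common_open_refinement[of "{1..n}" Y \<N>] \<N> by auto
  ultimately obtain f where f: "omega_map X Y \<T> f" "f ` topspace X = topspace Y"
    "maps_close X \<G> r f"
    using assms(4) unfolding refinable_map_def by blast

  have "family_refines (core X Y f ` \<gamma> i) (\<omega> i)" if i: "i \<in> {1..n}" for i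
    unfolding family_refines_def
  proof
    fix C
    assume "C \<in> core X Y f ` \<gamma> i"
    then obtain G where G: "G \<in> \<gamma> i" "C = core X Y f G"
      by blast
    then obtain L where L: "L \<in> \<L> i" "\<And>x. x \<in> G \<Longrightarrow> r x \<in> L"
      using ref[OF i] unfolding family_refines_def by blast
    then obtain U where U: "U \<in> \<omega> i" "\<And>N. N \<in> \<N> i \<Longrightarrow> N \<inter> L \<noteq> {} \<Longrightarrow> N \<subseteq> U"
      using star i by (meson atLeastAtMost_iff)
    have "C \<subseteq> U"
    proof
      fix y
      assume "y \<in> C"
      then obtain x where x: "x \<in> topspace X" "x \<in> G" "f x = y"
        using core_subset_image[OF f(2)] G(2) by blast
      then obtain M where M: "M \<in> \<G>" "r x \<in> M" "y \<in> M"
        using f(3) unfolding maps_close_def by blast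
      then obtain N where "N \<in> \<N> i" "M \<subseteq> N"
        using \<G>(2)[OF i] unfolding family_refines_def by blast
      with M have "N \<in> \<N> i" "r x \<in> N" "y \<in> N"
        by blast+
      then show "y \<in> U"
        using U(2) L(2)[OF x(2)] by blast
    qed
    then show "\<exists>U\<in>\<omega> i. C \<subseteq> U"
      using U(1) by blast
  qed
  moreover have "disjoint_open_family Y (core X Y f ` \<gamma> i)" if "i \<in> {1..n}" for i
    using disjoint_open_family_cores[OF f(2) disj[OF that]] .
  moreover have "family_refines \<T> (\<Union>i\<in>{1..n}. \<gamma> i)"
    unfolding \<T>_def family_refines_def by blast
  then have "open_cover_of Y (\<Union>i\<in>{1..n}. core X Y f ` \<gamma> i)"
    using open_cover_of_cores[OF f(1)] by (metis image_UN)
  ultimately show "\<exists>n \<gamma>. (\<forall>i\<in>{1..n}. disjoint_open_family Y (\<gamma> i) \<and>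
      family_refines (\<gamma> i) (\<omega> i)) \<and> open_cover_of Y (\<Union>i\<in>{1..n}. \<gamma> i)"
    by (intro exI[of _ n] exI[of _ "\<lambda>i. core X Y f ` \<gamma> i"]) simp
qed

end
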